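(* Let $G$ be a connected weighted graph with a cluster $(C,S)$, $|C|=c$, $|S|=s$, let $H$ be a weighted graph with vertex set $C$ such that $\mathbf{1}_c$ is an eigenvector of $M(H)$, and let $G(H)$ be the graph obtained from $G$ by adding the edges of $H$ on $C$. Let $\mathbf{x}\in\mathbb{R}^c$ satisfy $\mathbf{1}_c^T\mathbf{x}=0$. Then for all $t\in\mathbb{R}$, $$U_{G(H)}(t)\begin{bmatrix}\mathbf{x}\\ \mathbf{0}\end{bmatrix}=e^{i\delta t\,\mathbf{1}_s^T\mathbf{z}}\begin{bmatrix}U_H(t)\mathbf{x}\\ \mathbf{0}\end{bmatrix},$$ where $\mathbf{z}\in\mathbb{R}^s$ has components $\mathbf{z}(v)=\omega(u,v)$ for $v\in S$ (and any $u\in C$), and $\delta=0$ if $M=A$, $\delta=1$ if $M\in\{L,Q\}$.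
   Context: A weighted graph has positive edge weights; its adjacency matrix $A$ has $A_{ij}$ equal to the weight of edge $ij$ (0 if no edge), $\Delta$ is the diagonal matrix of row sums of $A$, $L=\Delta-A$, $Q=\Delta+A$. $M$ denotes any one of $A,L,Q$ (same choice for all graphs), and $U_X(t)=\exp(itM(X))$. Cluster: for $C,S\subseteq V(G)$ with $|C|\ge2$, the pair $(C,S)$ is a cluster in $G$ if the vertices of $C$ are pairwise non-adjacent, the neighbourhood of each $a\in C$ in $G$ is equal to $S$, and for each $v\in S$ the edge weight $\omega(u,v)$ is the same for all $u\in C$. $G(H)$ has vertex set $V(G)$ and edge set $E(G)\cup E(H)$, with edge weights from $G$ and $H$ preserved; its vertices are ordered with those of $C$ first. $\mathbf{1}_k$ is the all-ones vector of length $k$. *)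

theory Defs
  imports Complex_Main "Jordan_Normal_Form.Char_Poly"
begin

text \<open>Weighted graphs are finite, simple and undirected: edges are two-element sets of vertices.
  The weight function is only meaningful on edges.\<close>

record 'a wgraph =
  verts :: "'a set"
  edges :: "'a set set"
  weight :: "'a set \<Rightarrow> real"

definition weighted_graph :: "'a wgraph \<Rightarrow> bool" where
  "weighted_graph X \<longleftrightarrow> finite (verts X) \<and>
     (\<forall>e \<in> edges X. e \<subseteq> verts X \<and> card e = 2 \<and> weight X e > 0)"

definition neighbourhood :: "'a wgraph \<Rightarrow> 'a \<Rightarrow> 'a set" where
  "neighbourhood X u = {v. {u, v} \<in> edges X}"

definition connected_graph :: "'a wgraph \<Rightarrow> bool" where
  "connected_graph X \<longleftrightarrow> verts X \<noteq> {} \<and>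
     (\<forall>u \<in> verts X. \<forall>v \<in> verts X. (u, v) \<in> {(a, b). {a, b} \<in> edges X}\<^sup>*)"

definition cluster :: "'a wgraph \<Rightarrow> 'a set \<Rightarrow> 'a set \<Rightarrow> bool" where
  "cluster G C S \<longleftrightarrow> C \<subseteq> verts G \<and> S \<subseteq> verts G \<and> 2 \<le> card C \<and>
     (\<forall>a \<in> C. \<forall>b \<in> C. {a, b} \<notin> edges G) \<and>
     (\<forall>a \<in> C. neighbourhood G a = S) \<and>
     (\<forall>v \<in> S. \<forall>u \<in> C. \<forall>u' \<in> C. weight G {u, v} = weight G {u', v})"

text \<open>The graph \<open>G(H)\<close>. It is used when the vertices of \<open>H\<close> are pairwise
  non-adjacent in \<open>G\<close>, so no edge belongs to both graphs.\<close>

definition add_edges :: "'a wgraph \<Rightarrow> 'a wgraph \<Rightarrow> 'a wgraph" where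
  "add_edges G H = \<lparr> verts = verts G, edges = edges G \<union> edges H,
     weight = (\<lambda>e. if e \<in> edges G then weight G e else weight H e) \<rparr>"

text \<open>Matrices of a graph are taken with respect to an ordering of its vertices.\<close>

definition vertex_order :: "'a list \<Rightarrow> 'a wgraph \<Rightarrow> bool" where
  "vertex_order vs X \<longleftrightarrow> distinct vs \<and> set vs = verts X"

definition adjacency_mat :: "'a list \<Rightarrow> 'a wgraph \<Rightarrow> real mat" where
  "adjacency_mat vs X = mat (length vs) (length vs)
     (\<lambda>(i, j). if {vs ! i, vs ! j} \<in> edges X then weight X {vs ! i, vs ! j} else 0)"

definition degree_mat :: "'a list \<Rightarrow> 'a wgraph \<Rightarrow> real mat" where
  "degree_mat vs X = mat_diag (length vs) (\<lambda>i. \<Sum>j<length vs. adjacency_mat vs X $$ (i, j))"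

datatype mat_kind = Adjacency | Laplacian | Signless_Laplacian

fun graph_mat :: "mat_kind \<Rightarrow> 'a list \<Rightarrow> 'a wgraph \<Rightarrow> real mat" where
  "graph_mat Adjacency vs X = adjacency_mat vs X"
| "graph_mat Laplacian vs X = degree_mat vs X - adjacency_mat vs X"
| "graph_mat Signless_Laplacian vs X = degree_mat vs X + adjacency_mat vs X"

fun delta :: "mat_kind \<Rightarrow> real" where
  "delta Adjacency = 0"
| "delta Laplacian = 1"
| "delta Signless_Laplacian = 1"

text \<open>The exponential series of a square matrix, summed entrywise.\<close>

definition exp_mat :: "complex mat \<Rightarrow> complex mat" where
  "exp_mat B = mat (dim_row B) (dim_row B) (\<lambda>(i, j). \<Sum>k. (B ^\<^sub>m k) $$ (i, j) / fact k)"

definition transition_mat :: "mat_kind \<Rightarrow> 'a list \<Rightarrow> 'a wgraph \<Rightarrow> real \<Rightarrow> complex mat" where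
  "transition_mat M vs X t =
     exp_mat ((\<i> * complex_of_real t) \<cdot>\<^sub>m map_mat complex_of_real (graph_mat M vs X))"

definition ones_vec :: "nat \<Rightarrow> real vec" where
  "ones_vec k = vec k (\<lambda>_. 1)"

end

theory Submission imports Defs begin

text \<open>Let \<open>W\<close> be the space of vectors on \<open>C\<close> with coordinate sum zero. All vertices of \<open>C\<close> are joined to
  each outside vertex with the same weight, so \<open>M(G(H))\<close> maps a vector of \<open>W\<close>, padded with zeros, to a
  vector supported on \<open>C\<close>; there it acts as \<open>M(H)\<close> plus \<open>\<delta>\<close> times the degree into \<open>S\<close>. Since \<open>M(H)\<close> is symmetric with eigenvector \<open>1\<close>, it preserves \<open>W\<close>. Hence
  powers of \<open>M(G(H))\<close> on \<open>W\<close> expand binomially in powers of \<open>M(H)\<close>, and the Cauchy product of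
  exponential series splits off the scalar phase.\<close>

section \<open>Absolute convergence of the matrix exponential series\<close>

lemma pow_mat_entry_norm_le:
  fixes B :: "complex mat"
  assumes B: "B \<in> carrier_mat n n"
    and m: "\<And>i j. i < n \<Longrightarrow> j < n \<Longrightarrow> norm (B $$ (i, j)) \<le> m"
    and "i < n" "j < n"
  shows "norm ((B ^\<^sub>m k) $$ (i, j)) \<le> (real n * m) ^ k"
  using \<open>j < n\<close>
proof (induction k arbitrary: j)
  case 0
  then show ?case using B \<open>i < n\<close> by auto
next
  case (Suc k)
  have "(B ^\<^sub>m Suc k) $$ (i, j) = (\<Sum>l<n. (B ^\<^sub>m k) $$ (i, l) * B $$ (l, j))"
    using B Suc.prems \<open>i < n\<close> by (simp add: scalar_prod_def atLeast0LessThan)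
  also have "norm \<dots> \<le> (\<Sum>l<n. (real n * m) ^ k * m)"
    using Suc.prems by (intro sum_norm_le) (simp add: norm_mult mult_mono' Suc.IH m)
  also have "\<dots> = (real n * m) ^ Suc k"
    by (simp add: algebra_simps)
  finally show ?case .
qed

text \<open>Entries of the \<open>k\<close>-th power grow at most geometrically, so the exponential
  series at \<open>n * m\<close> dominates. Absolute convergence is recorded because the Cauchy
  product needs it later.\<close>

lemma summable_norm_pow_mat_entry:
  fixes B :: "complex mat"
  assumes B: "B \<in> carrier_mat n n" and "i < n" "j < n"
  shows "summable (\<lambda>k. norm ((B ^\<^sub>m k) $$ (i, j) / fact k))"
proof -
  \<comment> \<open>The sum of all entry norms serves as a uniform bound on the entries.\<close>
  define m where "m = (\<Sum>i<n. \<Sum>j<n. norm (B $$ (i, j)))"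
  have m: "norm (B $$ (i, j)) \<le> m" if "i < n" "j < n" for i j
  proof -
    have "norm (B $$ (i, j)) \<le> (\<Sum>j<n. norm (B $$ (i, j)))"
      using that by (intro member_le_sum) auto
    also have "\<dots> \<le> m"
      unfolding m_def using that by (intro member_le_sum) (auto intro: sum_nonneg)
    finally show ?thesis .
  qed
  show ?thesis
  proof (rule summable_comparison_test')
    show "summable (\<lambda>k. inverse (fact k) * (real n * m) ^ k)"
      by (rule summable_exp)
    show "norm (norm ((B ^\<^sub>m k) $$ (i, j) / fact k)) \<le> inverse (fact k) * (real n * m) ^ k" for k
      using pow_mat_entry_norm_le[OF B m assms(2,3), of k]
      by (simp add: norm_divide field_simps)
  qed
qed

lemma pow_mat_mult_vec_index:
  assumes "B \<in> carrier_mat n n" "y \<in> carrier_vec n" "i < n"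
  shows "((B ^\<^sub>m k) *\<^sub>v y) $ i = (\<Sum>j<n. (B ^\<^sub>m k) $$ (i, j) * y $ j)"
  using assms by (simp add: scalar_prod_def atLeast0LessThan)

lemma summable_norm_pow_mat_mult_vec:
  fixes B :: "complex mat"
  assumes B: "B \<in> carrier_mat n n" and y: "y \<in> carrier_vec n" and i: "i < n"
  shows "summable (\<lambda>k. norm (((B ^\<^sub>m k) *\<^sub>v y) $ i / fact k))"
proof (rule summable_comparison_test')
  show "summable (\<lambda>k. \<Sum>j<n. norm ((B ^\<^sub>m k) $$ (i, j) / fact k) * norm (y $ j))"
    using B i by (intro summable_sum summable_mult2 summable_norm_pow_mat_entry) auto
  show "norm (norm (((B ^\<^sub>m k) *\<^sub>v y) $ i / fact k))
      \<le> (\<Sum>j<n. norm ((B ^\<^sub>m k) $$ (i, j) / fact k) * norm (y $ j))" for k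
    unfolding pow_mat_mult_vec_index[OF assms] sum_divide_distrib real_norm_def abs_norm_cancel
    by (rule sum_norm_le) (simp add: norm_mult norm_divide)
qed

text \<open>The finite sum over columns commutes with the series. Hence \<open>exp_mat B\<close> on
  \<open>y\<close> is determined by the vectors \<open>B^k y\<close> alone, and only powers on a
  single vector have to be understood.\<close>

lemma exp_mat_mult_vec_sums:
  assumes B: "B \<in> carrier_mat n n" and y: "y \<in> carrier_vec n" and i: "i < n"
  shows "(\<lambda>k. ((B ^\<^sub>m k) *\<^sub>v y) $ i / fact k) sums (exp_mat B *\<^sub>v y) $ i"
proof -
  have "(\<lambda>k. \<Sum>j<n. (B ^\<^sub>m k) $$ (i, j) / fact k * y $ j) sums
      (\<Sum>j<n. (\<Sum>k. (B ^\<^sub>m k) $$ (i, j) / fact k) * y $ j)"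
    using B i
    by (intro sums_sum sums_mult2 summable_sums summable_norm_cancel[OF summable_norm_pow_mat_entry])
      auto
  moreover have "(\<Sum>j<n. (B ^\<^sub>m k) $$ (i, j) / fact k * y $ j) = ((B ^\<^sub>m k) *\<^sub>v y) $ i / fact k" for k
    unfolding pow_mat_mult_vec_index[OF assms] sum_divide_distrib by simp
  moreover have "(\<Sum>j<n. (\<Sum>k. (B ^\<^sub>m k) $$ (i, j) / fact k) * y $ j) = (exp_mat B *\<^sub>v y) $ i"
    using B y i by (simp add: exp_mat_def scalar_prod_def atLeast0LessThan)
  ultimately show ?thesis by simp
qed

section \<open>Exponentials on an invariant set of padded vectors\<close>

text \<open>Pascal's rule, as in the induction step of the binomial theorem. It will be used with
  \<open>g j\<close> an entry of \<open>K^j y\<close>, where one more application of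
  \<open>K + b\<close> yields \<open>g (Suc j) + b * g j\<close>.\<close>

lemma binomial_sum_Suc:
  fixes b :: "'a::comm_semiring_1"
  shows "(\<Sum>j\<le>n. of_nat (n choose j) * b ^ (n - j) * (g (Suc j) + b * g j))
       = (\<Sum>j\<le>Suc n. of_nat (Suc n choose j) * b ^ (Suc n - j) * g j)"
proof -
  have "(\<Sum>j\<le>Suc n. of_nat (Suc n choose j) * b ^ (Suc n - j) * g j)
      = b ^ Suc n * g 0 + (\<Sum>j\<le>n. of_nat (n choose Suc j) * b ^ (n - j) * g (Suc j))
        + (\<Sum>j\<le>n. of_nat (n choose j) * b ^ (n - j) * g (Suc j))"
    by (simp add: sum.atMost_Suc_shift sum.distrib algebra_simps del: sum.atMost_Suc)
  also have "b ^ Suc n * g 0 + (\<Sum>j\<le>n. of_nat (n choose Suc j) * b ^ (n - j) * g (Suc j))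
      = (\<Sum>j\<le>Suc n. of_nat (n choose j) * b ^ (Suc n - j) * g j)"
    by (simp add: sum.atMost_Suc_shift del: sum.atMost_Suc)
  \<comment> \<open>The top term drops out because \<open>n choose Suc n\<close> is 0.\<close>
  also have "\<dots> = (\<Sum>j\<le>n. of_nat (n choose j) * b ^ (Suc n - j) * g j)"
    by (simp add: binomial_eq_0)
  also have "\<dots> = (\<Sum>j\<le>n. of_nat (n choose j) * b ^ (n - j) * (b * g j))"
    by (intro sum.cong) (auto simp: Suc_diff_le mult_ac)
  finally show ?thesis
    by (simp add: sum.distrib algebra_simps)
qed

lemma pow_mat_Suc_mult_vec:
  assumes "B \<in> carrier_mat n n" "y \<in> carrier_vec n"
  shows "(B ^\<^sub>m Suc k) *\<^sub>v y = (B ^\<^sub>m k) *\<^sub>v (B *\<^sub>v y)"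
  using assms by (simp add: assoc_mult_mat_vec[of _ n n _ n])

text \<open>On padded vectors from \<open>W\<close>, \<open>B\<close> acts as \<open>K + b\<close>.
  The scalar \<open>b\<close> commutes with \<open>K\<close>, so the exponential of the sum factors
  into \<open>exp b\<close> and \<open>exp_mat K\<close>.\<close>

lemma exp_mat_invariant_subspace:
  assumes B: "B \<in> carrier_mat (c + d) (c + d)" and K: "K \<in> carrier_mat c c"
    and W: "W \<subseteq> carrier_vec c"
    and inv: "\<And>y. y \<in> W \<Longrightarrow> K *\<^sub>v y + b \<cdot>\<^sub>v y \<in> W"
    and act: "\<And>y. y \<in> W \<Longrightarrow> B *\<^sub>v (y @\<^sub>v 0\<^sub>v d) = (K *\<^sub>v y + b \<cdot>\<^sub>v y) @\<^sub>v 0\<^sub>v d"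
    and y: "y \<in> W"
  shows "exp_mat B *\<^sub>v (y @\<^sub>v 0\<^sub>v d) = exp b \<cdot>\<^sub>v ((exp_mat K *\<^sub>v y) @\<^sub>v 0\<^sub>v d)"
proof (rule eq_vecI)
  \<comment> \<open>The factor applied first is peeled off, so the vector changes in the induction:
    the hypothesis is used at \<open>K y + b y\<close>, again in \<open>W\<close>.\<close>
  have low: "((B ^\<^sub>m n) *\<^sub>v (y @\<^sub>v 0\<^sub>v d)) $ i
      = (\<Sum>j\<le>n. of_nat (n choose j) * b ^ (n - j) * ((K ^\<^sub>m j) *\<^sub>v y) $ i)"
    if "y \<in> W" "i < c" for n y i
    using that(1)
  proof (induction n arbitrary: y)
    case 0
    then have "y \<in> carrier_vec c" using W by auto
    then show ?case using B K \<open>i < c\<close> by (simp add: append_vec_def)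
  next
    case (Suc n)
    then have yc: "y \<in> carrier_vec c" using W by auto
    have step: "((K ^\<^sub>m j) *\<^sub>v (K *\<^sub>v y + b \<cdot>\<^sub>v y)) $ i
        = ((K ^\<^sub>m Suc j) *\<^sub>v y) $ i + b * ((K ^\<^sub>m j) *\<^sub>v y) $ i" for j
    proof -
      have "(K ^\<^sub>m j) *\<^sub>v (K *\<^sub>v y + b \<cdot>\<^sub>v y)
          = (K ^\<^sub>m Suc j) *\<^sub>v y + b \<cdot>\<^sub>v ((K ^\<^sub>m j) *\<^sub>v y)"
        using K yc
        by (simp add: pow_mat_Suc_mult_vec[OF K yc] mult_add_distrib_mat_vec[of _ c c] mult_mat_vec[of _ c c]
            del: pow_mat.simps)
      then show ?thesis using K yc \<open>i < c\<close> by simp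
    qed
    have "((B ^\<^sub>m Suc n) *\<^sub>v (y @\<^sub>v 0\<^sub>v d)) $ i
        = ((B ^\<^sub>m n) *\<^sub>v ((K *\<^sub>v y + b \<cdot>\<^sub>v y) @\<^sub>v 0\<^sub>v d)) $ i"
      using yc by (simp add: pow_mat_Suc_mult_vec[OF B] act[OF Suc.prems] del: pow_mat.simps)
    also have "\<dots> = (\<Sum>j\<le>n. of_nat (n choose j) * b ^ (n - j) *
        (((K ^\<^sub>m Suc j) *\<^sub>v y) $ i + b * ((K ^\<^sub>m j) *\<^sub>v y) $ i))"
      unfolding Suc.IH[OF inv[OF Suc.prems]] step ..
    also have "\<dots> = (\<Sum>j\<le>Suc n. of_nat (Suc n choose j) * b ^ (Suc n - j) * ((K ^\<^sub>m j) *\<^sub>v y) $ i)"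
      by (rule binomial_sum_Suc)
    finally show ?case .
  qed
  \<comment> \<open>By \<open>act\<close>, each application of \<open>B\<close> leaves the padding
    zero.\<close>
  have high: "((B ^\<^sub>m n) *\<^sub>v (y @\<^sub>v 0\<^sub>v d)) $ i = 0"
    if "y \<in> W" "c \<le> i" "i < c + d" for n y i
    using that(1)
  proof (induction n arbitrary: y)
    case 0
    then have "y \<in> carrier_vec c" using W by auto
    then show ?case using B that by (simp add: append_vec_def)
  next
    case (Suc n)
    then have "y \<in> carrier_vec c" using W by auto
    then show ?case using Suc.IH[OF inv[OF Suc.prems]]
      by (simp add: pow_mat_Suc_mult_vec[OF B] act[OF Suc.prems] del: pow_mat.simps)
  qed
  have yc: "y \<in> carrier_vec c" using y W by auto
  then have y0: "y @\<^sub>v 0\<^sub>v d \<in> carrier_vec (c + d)" by simp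
  have dimE: "dim_row (exp_mat B) = c + d" "dim_row (exp_mat K) = c"
    using B K by (auto simp: exp_mat_def)
  show "dim_vec (exp_mat B *\<^sub>v (y @\<^sub>v 0\<^sub>v d)) = dim_vec (exp b \<cdot>\<^sub>v ((exp_mat K *\<^sub>v y) @\<^sub>v 0\<^sub>v d))"
    by (simp add: dimE)
  fix i assume "i < dim_vec (exp b \<cdot>\<^sub>v ((exp_mat K *\<^sub>v y) @\<^sub>v 0\<^sub>v d))"
  then have i: "i < c + d" by (simp add: dimE)
  note sums = exp_mat_mult_vec_sums[OF B y0 i]
  show "(exp_mat B *\<^sub>v (y @\<^sub>v 0\<^sub>v d)) $ i = (exp b \<cdot>\<^sub>v ((exp_mat K *\<^sub>v y) @\<^sub>v 0\<^sub>v d)) $ i"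
  proof (cases "i < c")
    case True
    let ?g = "\<lambda>k. ((K ^\<^sub>m k) *\<^sub>v y) $ i / fact k"
    let ?e = "\<lambda>k. b ^ k / fact k"
    have e: "summable (\<lambda>k. norm (?e k))" "?e sums exp b"
      using summable_norm_exp[of b] exp_converges[of b]
      by (simp_all add: scaleR_conv_of_real field_simps)
    have "(\<lambda>k. \<Sum>j\<le>k. ?g j * ?e (k - j)) sums (suminf ?g * suminf ?e)"
      by (rule Cauchy_product_sums[OF summable_norm_pow_mat_mult_vec[OF K yc True] e(1)])
    moreover have "suminf ?g * suminf ?e = (exp_mat K *\<^sub>v y) $ i * exp b"
      using exp_mat_mult_vec_sums[OF K yc True] e(2) by (simp add: sums_iff)
    \<comment> \<open>Dividing the binomial expansion by \<open>k!\<close> turns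
      \<open>k choose j\<close> into \<open>1 / (j! (k - j)!)\<close>, which is exactly the Cauchy
      coefficient.\<close>
    moreover have "(\<Sum>j\<le>k. ?g j * ?e (k - j)) = ((B ^\<^sub>m k) *\<^sub>v (y @\<^sub>v 0\<^sub>v d)) $ i / fact k" for k
      unfolding low[OF y True] sum_divide_distrib
      by (intro sum.cong) (auto simp: binomial_fact field_simps)
    ultimately have "(exp_mat B *\<^sub>v (y @\<^sub>v 0\<^sub>v d)) $ i = (exp_mat K *\<^sub>v y) $ i * exp b"
      using sums by (simp add: sums_unique2)
    then show ?thesis using True i by (simp add: dimE append_vec_def)
  next
    case False
    then have "(exp_mat B *\<^sub>v (y @\<^sub>v 0\<^sub>v d)) $ i = 0"
      using sums high[OF y _ i] by (simp add: sums_iff)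
    then show ?thesis using False i by (simp add: dimE append_vec_def)
  qed
qed

lemma sum_lessThan_add:
  fixes f :: "nat \<Rightarrow> 'a::comm_monoid_add"
  shows "(\<Sum>l<m + n. f l) = (\<Sum>l<m. f l) + (\<Sum>l<n. f (m + l))"
  by (induction n) (auto simp: add.assoc)

section \<open>Entries and column sums of graph matrices\<close>

lemma adjacency_mat_carrier: "adjacency_mat vs X \<in> carrier_mat (length vs) (length vs)"
  by (simp add: adjacency_mat_def)

lemma graph_mat_carrier: "graph_mat M vs X \<in> carrier_mat (length vs) (length vs)"
  by (cases M) (auto simp: degree_mat_def adjacency_mat_def)

text \<open>Sign of \<open>A\<close> in the common form \<open>M = delta * D + adj_sign * A\<close>,
  with \<open>D\<close> the degree matrix. It spares a case split on \<open>M\<close> later.\<close>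

fun adj_sign :: "mat_kind \<Rightarrow> real" where
  "adj_sign Adjacency = 1"
| "adj_sign Laplacian = - 1"
| "adj_sign Signless_Laplacian = 1"

lemma graph_mat_index:
  assumes "i < length vs" "j < length vs"
  shows "graph_mat M vs X $$ (i, j) =
    (if i = j then delta M * (\<Sum>l<length vs. adjacency_mat vs X $$ (i, l)) else 0)
      + adj_sign M * adjacency_mat vs X $$ (i, j)"
  using assms adjacency_mat_carrier[of vs X]
  by (cases M) (auto simp: degree_mat_def mat_diag_def)

lemma graph_mat_symmetric:
  assumes "i < length vs" "j < length vs"
  shows "graph_mat M vs X $$ (i, j) = graph_mat M vs X $$ (j, i)"
  using assms by (auto simp: graph_mat_index adjacency_mat_def insert_commute)

text \<open>The eigenvector equation gives the row sums; symmetry makes them column sums, which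
  control the coordinate sum of an image vector.\<close>

lemma graph_mat_col_sum:
  assumes "eigenvector (graph_mat M vs X) (ones_vec n) \<mu>" "j < length vs" "n = length vs"
  shows "(\<Sum>i<length vs. graph_mat M vs X $$ (i, j)) = \<mu>"
proof -
  have "(graph_mat M vs X *\<^sub>v ones_vec n) $ j = (\<mu> \<cdot>\<^sub>v ones_vec n) $ j"
    using assms(1) by (simp add: eigenvector_def)
  then have "(\<Sum>i<length vs. graph_mat M vs X $$ (j, i)) = \<mu>"
    using assms graph_mat_carrier[of M vs X]
    by (simp add: scalar_prod_def ones_vec_def atLeast0LessThan)
  then show ?thesis using assms by (simp add: graph_mat_symmetric[of _ vs j])
qed

theorem lemma3:
  fixes G H :: "'a wgraph" and C S :: "'a set" and cs ds ss :: "'a list"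
    and M :: mat_kind and c s :: nat and u :: "'a" and x z :: "real vec" and t :: real
  assumes "weighted_graph G" and "connected_graph G"
    and "cluster G C S"
    and "weighted_graph H" and "verts H = C"
    and "vertex_order cs H"
    and "vertex_order (cs @ ds) (add_edges G H)"
    and "distinct ss" and "set ss = S"
    and "c = card C" and "s = card S"
    and "\<exists>\<mu>. eigenvector (graph_mat M cs H) (ones_vec c) \<mu>"
    and "x \<in> carrier_vec c" and "ones_vec c \<bullet> x = 0"
    and "u \<in> C" and "z = vec s (\<lambda>i. weight G {u, ss ! i})"
  shows "transition_mat M (cs @ ds) (add_edges G H) t
           *\<^sub>v (map_vec complex_of_real x @\<^sub>v 0\<^sub>v (length ds))
         = exp (\<i> * complex_of_real (delta M * t * (ones_vec s \<bullet> z)))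
           \<cdot>\<^sub>v ((transition_mat M cs H t *\<^sub>v map_vec complex_of_real x) @\<^sub>v 0\<^sub>v (length ds))"
proof -
  let ?X = "add_edges G H" and ?d = "length ds"
  define \<sigma> where "\<sigma> = (\<Sum>v\<in>S. weight G {u, v})"
  define k where "k = \<i> * complex_of_real t"
  define A where "A = adjacency_mat (cs @ ds) ?X"
  define AH where "AH = adjacency_mat cs H"
  define B where "B = k \<cdot>\<^sub>m map_mat complex_of_real (graph_mat M (cs @ ds) ?X)"
  define K where "K = k \<cdot>\<^sub>m map_mat complex_of_real (graph_mat M cs H)"
  define b where "b = k * complex_of_real (delta M * \<sigma>)"
  \<comment> \<open>Complex vectors are needed, since \<open>K\<close> carries the factor
    \<open>k = i t\<close>.\<close>
  define W where "W = {y \<in> carrier_vec c. (\<Sum>j<c. y $ j) = (0::complex)}"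
  have cs: "distinct cs" "set cs = C" and ds: "distinct ds" "set cs \<inter> set ds = {}"
    and csds: "set cs \<union> set ds = verts G"
    using assms(5-7) by (auto simp: vertex_order_def add_edges_def)
  have len: "length cs = c" using cs assms(10) distinct_card by fastforce
  have indep: "{a, a'} \<notin> edges G" if "a \<in> C" "a' \<in> C" for a a'
    using assms(3) that by (auto simp: cluster_def)
  have nbh: "{a, v} \<in> edges G \<longleftrightarrow> v \<in> S" if "a \<in> C" for a v
    using assms(3) that by (auto simp: cluster_def neighbourhood_def)
  have wt: "weight G {a, v} = weight G {u, v}" if "a \<in> C" "v \<in> S" for a v
    using assms(3) that \<open>u \<in> C\<close> unfolding cluster_def by blast
  have H_edges: "e \<subseteq> C" if "e \<in> edges H" for e
    using assms(4,5) that by (auto simp: weighted_graph_def)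
  have S_ds: "S \<subseteq> set ds"
  proof -
    have "S \<subseteq> verts G" using assms(3) by (simp add: cluster_def)
    moreover have "S \<inter> C = {}" using nbh[OF \<open>u \<in> C\<close>] indep[OF \<open>u \<in> C\<close>] by auto
    ultimately show ?thesis using csds cs(2) by blast
  qed
  have cs_nth: "cs ! i \<in> C" if "i < c" for i using that cs len by auto
  have ds_nth: "ds ! i \<in> set ds" if "i < ?d" for i using that by auto

  have sz: "ones_vec s \<bullet> z = \<sigma>"
  proof -
    have "length ss = s" using assms(8,9,11) distinct_card by fastforce
    then have "ones_vec s \<bullet> z = (\<Sum>i<length ss. weight G {u, ss ! i})"
      by (simp add: assms(16) ones_vec_def scalar_prod_def atLeast0LessThan)
    also have "\<dots> = (\<Sum>v\<in>set ss. weight G {u, v})"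
      using assms(8) by (intro sum.reindex_bij_betw bij_betw_nth) auto
    finally show ?thesis by (simp add: \<sigma>_def assms(9))
  qed

  \<comment> \<open>Block structure of the matrix of \<open>G(H)\<close>\<close>
  have A_CC: "A $$ (i, j) = AH $$ (i, j)" if "i < c" "j < c" for i j
    using that indep[OF cs_nth cs_nth, of i j]
    by (auto simp: A_def AH_def adjacency_mat_def len nth_append add_edges_def)
  \<comment> \<open>The value is free of \<open>i\<close>: the cluster condition equates all rows of
    this block, and edges of \<open>H\<close> stay inside \<open>C\<close>.\<close>
  have A_CD: "A $$ (i, c + j) = (if ds ! j \<in> S then weight G {u, ds ! j} else 0)"
    if "i < c" "j < ?d" for i j
  proof -
    have "ds ! j \<notin> C" using ds_nth[OF that(2)] ds(2) cs(2) by auto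
    then have "{cs ! i, ds ! j} \<notin> edges H" using H_edges by auto
    then show ?thesis using that nbh[OF cs_nth, of i] wt[OF cs_nth, of i]
      by (auto simp: A_def adjacency_mat_def len nth_append add_edges_def)
  qed
  have A_sym: "A $$ (i, j) = A $$ (j, i)" if "i < c + ?d" "j < c + ?d" for i j
    using that by (simp add: A_def adjacency_mat_def len insert_commute)
  \<comment> \<open>The excess over the degree in \<open>H\<close> is the same
    \<open>\<sigma>\<close> at every vertex of \<open>C\<close>; it is the source of the scalar
    \<open>b\<close>.\<close>
  have deg: "(\<Sum>l<c + ?d. A $$ (i, l)) = (\<Sum>l<c. AH $$ (i, l)) + \<sigma>" if "i < c" for i
  proof -
    have "(\<Sum>l<?d. if ds ! l \<in> S then weight G {u, ds ! l} else 0)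
        = (\<Sum>v\<in>set ds. if v \<in> S then weight G {u, v} else 0)"
      using ds(1) by (intro sum.reindex_bij_betw bij_betw_nth) auto
    also have "\<dots> = \<sigma>"
      using S_ds by (simp add: \<sigma>_def sum.If_cases Int_absorb1)
    finally have "(\<Sum>l<?d. A $$ (i, c + l)) = \<sigma>"
      using that by (simp add: A_CD)
    moreover have "(\<Sum>l<c + ?d. A $$ (i, l)) = (\<Sum>l<c. A $$ (i, l)) + (\<Sum>l<?d. A $$ (i, c + l))"
      by (rule sum_lessThan_add)
    ultimately show ?thesis using that by (simp add: A_CC)
  qed

  have Bc: "B \<in> carrier_mat (c + ?d) (c + ?d)" and Kc: "K \<in> carrier_mat c c"
    using graph_mat_carrier[of M "cs @ ds" ?X] graph_mat_carrier[of M cs H]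
    by (auto simp: B_def K_def len)
  have B_index: "B $$ (i, j) = k * complex_of_real
      ((if i = j then delta M * (\<Sum>l<c + ?d. A $$ (i, l)) else 0) + adj_sign M * A $$ (i, j))"
    if "i < c + ?d" "j < c + ?d" for i j
    using that graph_mat_carrier[of M "cs @ ds" ?X]
    by (simp add: B_def A_def graph_mat_index len)
  have K_index: "K $$ (i, j) = k * complex_of_real
      ((if i = j then delta M * (\<Sum>l<c. AH $$ (i, l)) else 0) + adj_sign M * AH $$ (i, j))"
    if "i < c" "j < c" for i j
    using that graph_mat_carrier[of M cs H]
    by (simp add: K_def AH_def graph_mat_index len)
  have B_CC: "B $$ (i, j) = K $$ (i, j) + (if i = j then b else 0)" if "i < c" "j < c" for i j
    using that by (simp add: B_index K_index deg A_CC b_def algebra_simps)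
  \<comment> \<open>Off the diagonal no degree enters, so each such row is constant in
    \<open>j\<close> and annihilates zero-sum vectors.\<close>
  have B_DC: "B $$ (c + i, j) =
      k * complex_of_real (adj_sign M * (if ds ! i \<in> S then weight G {u, ds ! i} else 0))"
    if "i < ?d" "j < c" for i j
    using that by (simp add: B_index A_sym[of "c + i" j] A_CD)

  \<comment> \<open>Action on zero-sum vectors and their invariance\<close>
  have act: "B *\<^sub>v (y @\<^sub>v 0\<^sub>v ?d) = (K *\<^sub>v y + b \<cdot>\<^sub>v y) @\<^sub>v 0\<^sub>v ?d" if "y \<in> W" for y
  proof (rule eq_vecI)
    have y: "y \<in> carrier_vec c" "(\<Sum>j<c. y $ j) = 0" using that by (auto simp: W_def)
    show "dim_vec (B *\<^sub>v (y @\<^sub>v 0\<^sub>v ?d)) = dim_vec ((K *\<^sub>v y + b \<cdot>\<^sub>v y) @\<^sub>v 0\<^sub>v ?d)"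
      using Bc Kc y by simp
    fix i assume "i < dim_vec ((K *\<^sub>v y + b \<cdot>\<^sub>v y) @\<^sub>v 0\<^sub>v ?d)"
    then have i: "i < c + ?d" using Kc y by simp
    have "(B *\<^sub>v (y @\<^sub>v 0\<^sub>v ?d)) $ i = (\<Sum>j<c + ?d. B $$ (i, j) * (y @\<^sub>v 0\<^sub>v ?d) $ j)"
      using Bc y i by (simp add: scalar_prod_def atLeast0LessThan)
    also have "\<dots> = (\<Sum>j<c. B $$ (i, j) * y $ j)"
      using y by (intro sum.mono_neutral_cong_right) (auto simp: append_vec_def)
    finally have By: "(B *\<^sub>v (y @\<^sub>v 0\<^sub>v ?d)) $ i = (\<Sum>j<c. B $$ (i, j) * y $ j)" .
    show "(B *\<^sub>v (y @\<^sub>v 0\<^sub>v ?d)) $ i = ((K *\<^sub>v y + b \<cdot>\<^sub>v y) @\<^sub>v 0\<^sub>v ?d) $ i"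
    proof (cases "i < c")
      case True
      have "(\<Sum>j<c. B $$ (i, j) * y $ j)
          = (\<Sum>j<c. K $$ (i, j) * y $ j) + (\<Sum>j<c. if i = j then b * y $ j else 0)"
        unfolding sum.distrib[symmetric] using True
        by (intro sum.cong) (auto simp: B_CC algebra_simps)
      then show ?thesis using By True y Kc
        by (simp add: append_vec_def scalar_prod_def atLeast0LessThan)
    next
      case False
      then obtain i' where i': "i = c + i'" "i' < ?d" using i
        by (metis add_less_cancel_left le_Suc_ex not_less)
      have "(\<Sum>j<c. B $$ (i, j) * y $ j) = 0"
        using y(2) i' by (simp add: B_DC flip: sum_distrib_left)
      then show ?thesis using By False i y Kc by (simp add: append_vec_def)
    qed
  qed

  have inv: "K *\<^sub>v y + b \<cdot>\<^sub>v y \<in> W" if "y \<in> W" for y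
  proof -
    have y: "y \<in> carrier_vec c" "(\<Sum>j<c. y $ j) = 0" using that by (auto simp: W_def)
    obtain \<mu> where \<mu>: "eigenvector (graph_mat M cs H) (ones_vec c) \<mu>" using assms(12) by blast
    have col: "(\<Sum>i<c. K $$ (i, j)) = k * complex_of_real \<mu>" if "j < c" for j
    proof -
      have "(\<Sum>i<c. K $$ (i, j)) = (\<Sum>i<c. k * complex_of_real (graph_mat M cs H $$ (i, j)))"
        using that graph_mat_carrier[of M cs H] by (intro sum.cong) (auto simp: K_def len)
      also have "\<dots> = k * complex_of_real (\<Sum>i<c. graph_mat M cs H $$ (i, j))"
        unfolding of_real_sum sum_distrib_left ..
      also have "(\<Sum>i<c. graph_mat M cs H $$ (i, j)) = \<mu>"
        using graph_mat_col_sum[OF \<mu> _ len[symmetric], of j] that by (simp add: len)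
      finally show ?thesis .
    qed
    \<comment> \<open>Swapping the sums brings in the column sums of \<open>K\<close>, all equal to
      \<open>k * \<mu>\<close>, so the total is a multiple of the coordinate sum of
      \<open>y\<close>.\<close>
    have "(\<Sum>i<c. (K *\<^sub>v y) $ i) = (\<Sum>i<c. \<Sum>j<c. K $$ (i, j) * y $ j)"
      using Kc y by (intro sum.cong) (auto simp: scalar_prod_def atLeast0LessThan)
    also have "\<dots> = (\<Sum>j<c. (\<Sum>i<c. K $$ (i, j)) * y $ j)"
      by (subst sum.swap) (simp add: sum_distrib_right)
    also have "\<dots> = 0"
      using y(2) by (simp add: col flip: sum_distrib_left)
    finally have "(\<Sum>i<c. (K *\<^sub>v y) $ i) = 0" .
    then show ?thesis using y Kc
      by (simp add: W_def sum.distrib sum_distrib_left[symmetric] del: index_mult_mat_vec)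
  qed

  have xW: "map_vec complex_of_real x \<in> W"
    using assms(13,14)
    by (simp add: W_def ones_vec_def scalar_prod_def atLeast0LessThan flip: of_real_sum)
  have "exp_mat B *\<^sub>v (map_vec complex_of_real x @\<^sub>v 0\<^sub>v ?d)
      = exp b \<cdot>\<^sub>v ((exp_mat K *\<^sub>v map_vec complex_of_real x) @\<^sub>v 0\<^sub>v ?d)"
    by (rule exp_mat_invariant_subspace[OF Bc Kc _ inv act xW]) (auto simp: W_def)
  moreover have "b = \<i> * complex_of_real (delta M * t * (ones_vec s \<bullet> z))"
    by (simp add: b_def k_def sz mult_ac)
  ultimately show ?thesis
    unfolding transition_mat_def B_def K_def k_def by argo
qed

end
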